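(* Let $\alpha\in]0;1[$ be a fixed constant, let $\sigma_0^2>0$, and let $\Upsilon$ be the test of $H_0:\sigma^2=\sigma_0^2$ versus $H_1:\sigma^2>\sigma_0^2$ which rejects $H_0$ if $$S\ \geq\ z_{1-\alpha}:=\frac{\sigma_0^2}{n}\,q_{\chi^2_n(\lambda(\sigma_0)),\,1-\alpha}.$$ Then the test $\Upsilon$ is of Type I error $\alpha$, i.e. $\mathbb{P}_{\sigma_0^2}(S\geq z_{1-\alpha})=\alpha$, and therefore it is of level $\alpha$. Further, let $\beta\in]0;1[$ be a constant such that $1-\beta\geq\alpha$. For all $\sigma^2>0$ such that $$\sigma^2\ \geq\ \sigma_0^2\,\frac{q_{\chi^2_n(\lambda(\sigma_0)),\,1-\alpha}}{q_{\chi^2_n(\lambda(\sigma)),\,\beta}},$$ the test $\Upsilon$ satisfies $\mathbb{P}_{\sigma^2}(\Upsilon\text{ accepts }H_0)\leq\beta$. This condition on $\sigma^2$ is sufficient and necessary for $\mathbb{P}_{\sigma^2}(\Upsilon\text{ accepts }H_0)\leq\beta$.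
   Context: Consider the one-dimensional SDE $dX_t=b_t\,dt+\sigma\,dW_t$, $X_0=x_0$, $t>0$, where $b_t$ is a known deterministic real drift function depending only on time (integrable on $[0,T]$), $\sigma$ is a constant diffusion coefficient and $W$ is a one-dimensional Brownian motion. The process is observed at times $i\Delta$, $i=0,\dots,n$, with fixed $\Delta>0$ and $n\Delta=T$. $\mathbb{P}_{\sigma^2}$ denotes the probability when the squared diffusion coefficient equals $\sigma^2$. The normalized increments are $\xi_i=\frac{X_{i\Delta}-X_{(i-1)\Delta}}{\sqrt\Delta}$, $i=1,\dots,n$, and the test statistic is $S=\frac1n\sum_{i=1}^n\xi_i^2$. Set $$\lambda(\sigma)=\frac{\sum_{i=1}^n\left(\int_{(i-1)\Delta}^{i\Delta}b_s\,ds\right)^2}{\sigma^2\Delta}.$$ $\chi^2_n(\lambda)$ is the (non-central) chi-squared distribution with $n$ degrees of freedom and non-centrality parameter $\lambda$, and $q_{\chi^2_n(\lambda),\beta}$ is its quantile of order $\beta$ (the value $q$ with probability $\beta$ of being at most $q$). A test accepts $H_0$ when it does not reject it; level $\alpha$ means that the probability of rejecting under $H_0$ is at most $\alpha$. *)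

theory Defs
  imports "HOL-Probability.Probability"
begin

locale brownian_motion = prob_space M
  for M :: "'a measure" and W :: "real \<Rightarrow> 'a \<Rightarrow> real" +
  assumes measurable_W: "\<And>t. 0 \<le> t \<Longrightarrow> W t \<in> borel_measurable M"
    and starts_at_0: "AE \<omega> in M. W 0 \<omega> = 0"
    and normal_increments: "\<And>s t. 0 \<le> s \<Longrightarrow> s < t \<Longrightarrow>
      distributed M lborel (\<lambda>\<omega>. W t \<omega> - W s \<omega>) (normal_density 0 (sqrt (t - s)))"
    and indep_increments: "\<And>(t :: nat \<Rightarrow> real) k. 0 \<le> t 0 \<Longrightarrow> (\<And>i. i < k \<Longrightarrow> t i < t (Suc i)) \<Longrightarrow>
      indep_vars (\<lambda>_. borel) (\<lambda>i \<omega>. W (t (Suc i)) \<omega> - W (t i) \<omega>) {..<k}"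
    and continuous_paths: "AE \<omega> in M. continuous_on {0..} (\<lambda>t. W t \<omega>)"

text \<open>
  The equation \<open>dX\<^sub>t = b\<^sub>t dt + \<sigma> dW\<^sub>t\<close>, \<open>X\<^sub>0 = x\<^sub>0\<close>, in integral form on \<open>[0, T]\<close>. Since \<open>\<sigma>\<close> is a
  constant, the stochastic integral of \<open>\<sigma>\<close> over \<open>[0, t]\<close> is \<open>\<sigma> (W\<^sub>t - W\<^sub>0) = \<sigma> W\<^sub>t\<close>. The drift \<open>b\<close> is
  meant to be absolutely (i.e. Lebesgue) integrable on \<open>[0, T]\<close>, so that the Henstock-Kurzweil
  integral used here is its Lebesgue integral.
\<close>
definition sde_solution ::
  "'a measure \<Rightarrow> (real \<Rightarrow> 'a \<Rightarrow> real) \<Rightarrow> real \<Rightarrow> (real \<Rightarrow> real) \<Rightarrow> real \<Rightarrow> real \<Rightarrow> (real \<Rightarrow> 'a \<Rightarrow> real) \<Rightarrow> bool"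
  where "sde_solution M W x0 b \<sigma> T X \<longleftrightarrow>
    (\<forall>t\<in>{0..T}. X t \<in> borel_measurable M) \<and>
    (AE \<omega> in M. \<forall>t\<in>{0..T}. X t \<omega> = x0 + integral {0..t} b + \<sigma> * W t \<omega>)"

text \<open>
  The statistical model: \<open>X\<close> is the observed process and \<open>P v\<close> is the probability when the squared
  diffusion coefficient equals \<open>v\<close>. The driving Brownian motion may depend on \<open>v\<close>.
\<close>
definition diffusion_model ::
  "(real \<Rightarrow> 'a measure) \<Rightarrow> (real \<Rightarrow> 'a \<Rightarrow> real) \<Rightarrow> real \<Rightarrow> (real \<Rightarrow> real) \<Rightarrow> real \<Rightarrow> bool"
  where "diffusion_model P X x0 b T \<longleftrightarrow>
    (\<forall>v>0. \<exists>W \<sigma>. \<sigma>\<^sup>2 = v \<and> brownian_motion (P v) W \<and> sde_solution (P v) W x0 b \<sigma> T X)"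

text \<open>
  The law of \<open>(Z\<^sub>0 + \<surd>\<lambda>)\<^sup>2 + Z\<^sub>1\<^sup>2 + \<dots> + Z\<^sub>n\<^sub>-\<^sub>1\<^sup>2\<close> for independent standard normal \<open>Z\<^sub>0, \<dots>, Z\<^sub>n\<^sub>-\<^sub>1\<close>, where
  \<open>n \<ge> 1\<close> and \<open>\<lambda> \<ge> 0\<close>. By rotation invariance this is the law of \<open>\<Sum>\<^sub>i (Z\<^sub>i + \<mu>\<^sub>i)\<^sup>2\<close> for every mean
  vector \<open>\<mu>\<close> with \<open>\<Sum>\<^sub>i \<mu>\<^sub>i\<^sup>2 = \<lambda>\<close>.
\<close>
definition noncentral_chi_squared :: "nat \<Rightarrow> real \<Rightarrow> real measure"
  where "noncentral_chi_squared n l =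
    distr (\<Pi>\<^sub>M i\<in>{..<n}. density lborel std_normal_density) borel
      (\<lambda>z. \<Sum>i<n. (z i + (if i = 0 then sqrt l else 0))\<^sup>2)"

text \<open>
  Meaningful when exactly one \<open>q\<close> satisfies the equation, as for non-central chi-squared laws with
  at least one degree of freedom and \<open>0 < p < 1\<close>.
\<close>
definition quantile :: "real measure \<Rightarrow> real \<Rightarrow> real"
  where "quantile M p = (THE q. cdf M q = p)"

definition normalized_increment :: "(real \<Rightarrow> 'a \<Rightarrow> real) \<Rightarrow> real \<Rightarrow> nat \<Rightarrow> 'a \<Rightarrow> real"
  where "normalized_increment X \<Delta> i \<omega> = (X (real i * \<Delta>) \<omega> - X ((real i - 1) * \<Delta>) \<omega>) / sqrt \<Delta>"

definition test_statistic :: "(real \<Rightarrow> 'a \<Rightarrow> real) \<Rightarrow> real \<Rightarrow> nat \<Rightarrow> 'a \<Rightarrow> real"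
  where "test_statistic X \<Delta> n \<omega> = (1 / real n) * (\<Sum>i=1..n. (normalized_increment X \<Delta> i \<omega>)\<^sup>2)"

definition noncentrality :: "(real \<Rightarrow> real) \<Rightarrow> real \<Rightarrow> nat \<Rightarrow> real \<Rightarrow> real"
  where "noncentrality b \<Delta> n \<sigma> =
    (\<Sum>i=1..n. (integral {(real i - 1) * \<Delta>..real i * \<Delta>} b)\<^sup>2) / (\<sigma>\<^sup>2 * \<Delta>)"

definition chi_quantile :: "(real \<Rightarrow> real) \<Rightarrow> real \<Rightarrow> nat \<Rightarrow> real \<Rightarrow> real \<Rightarrow> real"
  where "chi_quantile b \<Delta> n \<sigma> p = quantile (noncentral_chi_squared n (noncentrality b \<Delta> n \<sigma>)) p"

definition critical_value :: "(real \<Rightarrow> real) \<Rightarrow> real \<Rightarrow> nat \<Rightarrow> real \<Rightarrow> real \<Rightarrow> real"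
  where "critical_value b \<Delta> n \<sigma>0 \<alpha> = \<sigma>0\<^sup>2 / real n * chi_quantile b \<Delta> n \<sigma>0 (1 - \<alpha>)"

definition test_rejects ::
  "(real \<Rightarrow> real) \<Rightarrow> real \<Rightarrow> nat \<Rightarrow> real \<Rightarrow> real \<Rightarrow> (real \<Rightarrow> 'a \<Rightarrow> real) \<Rightarrow> 'a \<Rightarrow> bool"
  where "test_rejects b \<Delta> n \<sigma>0 \<alpha> X \<omega> \<longleftrightarrow>
    test_statistic X \<Delta> n \<omega> \<ge> critical_value b \<Delta> n \<sigma>0 \<alpha>"

definition test_accepts ::
  "(real \<Rightarrow> real) \<Rightarrow> real \<Rightarrow> nat \<Rightarrow> real \<Rightarrow> real \<Rightarrow> (real \<Rightarrow> 'a \<Rightarrow> real) \<Rightarrow> 'a \<Rightarrow> bool"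
  where "test_accepts b \<Delta> n \<sigma>0 \<alpha> X \<omega> \<longleftrightarrow> \<not> test_rejects b \<Delta> n \<sigma>0 \<alpha> X \<omega>"

text \<open>\<open>H0\<close> is the set of parameter values that make up the null hypothesis.\<close>
definition has_level :: "(real \<Rightarrow> 'a measure) \<Rightarrow> real set \<Rightarrow> ('a \<Rightarrow> bool) \<Rightarrow> real \<Rightarrow> bool"
  where "has_level P H0 rejects \<alpha> \<longleftrightarrow> (\<forall>v\<in>H0. measure (P v) {\<omega>\<in>space (P v). rejects \<omega>} \<le> \<alpha>)"

end

theory Submission
  imports Defs
begin

text \<open>
  Up to the factor \<open>\<sigma>\<^sup>2\<close>, the statistic \<open>n S\<close> is almost surely a sum of squares of independent shifted
  standard normal variables. Its law is the convolution of the laws of the single squares. In two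
  dimensions, rotation invariance of the Gaussian weight moves the whole shift into one coordinate;
  since convolution is commutative and associative, only the sum of the squared shifts matters,
  which gives the non-central chi-squared law. That law has no atoms and charges every interval of
  the positive half-line, so its distribution function can be inverted.
\<close>

section \<open>Rotation invariance of Lebesgue measure on the plane\<close>

text \<open>Two one-dimensional affine substitutions with Fubini between them:
  \<open>x = (u - b * y) / a\<close> at fixed \<open>y\<close>, then
  \<open>y = b * u + a * v\<close> at fixed \<open>u\<close>. Their Jacobians
  \<open>\<bar>1 / a\<bar>\<close> and \<open>\<bar>a\<bar>\<close> cancel.\<close>

lemma nn_integral_lborel_rotation:
  fixes a b :: real and h :: "real \<Rightarrow> real \<Rightarrow> ennreal"
  assumes [measurable]: "case_prod h \<in> borel_measurable (borel \<Otimes>\<^sub>M borel)"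
    and a: "a \<noteq> 0" and ab: "a\<^sup>2 + b\<^sup>2 = 1"
  shows "(\<integral>\<^sup>+y. \<integral>\<^sup>+x. h x y \<partial>lborel \<partial>lborel)
    = (\<integral>\<^sup>+u. \<integral>\<^sup>+v. h (a * u - b * v) (b * u + a * v) \<partial>lborel \<partial>lborel)"
proof -
  \<comment> \<open>The composite of the two substitutions is the rotation; this is where
    \<open>a\<^sup>2 + b\<^sup>2 = 1\<close> enters.\<close>
  have rot: "(u - b * (b * u + a * v)) / a = a * u - b * v" for u v
  proof -
    have "u - b * (b * u + a * v) = a * (a * u - b * v)"
      using ab by algebra
    then show ?thesis using a by simp
  qed
  have "(\<integral>\<^sup>+y. \<integral>\<^sup>+x. h x y \<partial>lborel \<partial>lborel)
      = (\<integral>\<^sup>+y. ennreal \<bar>1 / a\<bar> * (\<integral>\<^sup>+u. h ((u - b * y) / a) y \<partial>lborel) \<partial>lborel)"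
    using a by (intro nn_integral_cong, subst nn_integral_real_affine[where c = "1 / a" and t = "- b * _ / a"])
      (auto simp: diff_divide_distrib)
  also have "\<dots> = ennreal \<bar>1 / a\<bar> * (\<integral>\<^sup>+y. \<integral>\<^sup>+u. h ((u - b * y) / a) y \<partial>lborel \<partial>lborel)"
    by (rule nn_integral_cmult) measurable
  also have "(\<integral>\<^sup>+y. \<integral>\<^sup>+u. h ((u - b * y) / a) y \<partial>lborel \<partial>lborel)
      = (\<integral>\<^sup>+u. \<integral>\<^sup>+y. h ((u - b * y) / a) y \<partial>lborel \<partial>lborel)"
    by (rule lborel_pair.Fubini') measurable
  also have "\<dots> = (\<integral>\<^sup>+u. ennreal \<bar>a\<bar> * (\<integral>\<^sup>+v. h ((u - b * (b * u + a * v)) / a) (b * u + a * v) \<partial>lborel) \<partial>lborel)"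
    using a by (intro nn_integral_cong, subst nn_integral_real_affine[where c = a and t = "b * _"]) auto
  also have "\<dots> = ennreal \<bar>a\<bar> * (\<integral>\<^sup>+u. \<integral>\<^sup>+v. h (a * u - b * v) (b * u + a * v) \<partial>lborel \<partial>lborel)"
    unfolding rot by (rule nn_integral_cmult) measurable
  also have "ennreal \<bar>1 / a\<bar> * (ennreal \<bar>a\<bar> * I) = I" for I
    using a by (simp add: mult.assoc[symmetric] ennreal_mult[symmetric] abs_mult[symmetric])
  finally show ?thesis .
qed

section \<open>Squares of shifted normal variables\<close>

text \<open>The non-central chi-squared law with one degree of freedom and non-centrality
  \<open>m\<^sup>2\<close>.\<close>

definition shifted_normal_square :: "real \<Rightarrow> real measure"
  where "shifted_normal_square m = distr std_normal_distribution borel (\<lambda>z. (z + m)\<^sup>2)"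

lemma sets_shifted_normal_square [simp, measurable_cong]: "sets (shifted_normal_square m) = sets borel"
  by (simp add: shifted_normal_square_def)

lemma prob_space_shifted_normal_square: "prob_space (shifted_normal_square m)"
  unfolding shifted_normal_square_def
  by (intro prob_space.prob_space_distr prob_space_normal_density) auto

lemma finite_measure_shifted_normal_square [simp]: "finite_measure (shifted_normal_square m)"
  using prob_space_shifted_normal_square prob_space_def by blast

lemma nn_integral_shifted_normal_square:
  assumes [measurable]: "f \<in> borel_measurable borel"
  shows "(\<integral>\<^sup>+x. f x \<partial>shifted_normal_square m)
    = (\<integral>\<^sup>+z. ennreal (std_normal_density z) * f ((z + m)\<^sup>2) \<partial>lborel)"
  unfolding shifted_normal_square_def
  by (simp add: nn_integral_distr nn_integral_density)

text \<open>The reflection of \<open>z\<close> to \<open>- z\<close> preserves the standard normal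
  law. The sign has to be dropped because a single shift \<open>m\<close> will reappear as
  \<open>sqrt (m\<^sup>2)\<close>.\<close>

lemma shifted_normal_square_abs: "shifted_normal_square \<bar>m\<bar> = shifted_normal_square m"
proof (rule measure_eqI)
  fix A assume "A \<in> sets (shifted_normal_square \<bar>m\<bar>)"
  then have [measurable]: "A \<in> sets borel" by simp
  have sq: "(- z - m)\<^sup>2 = (z + m)\<^sup>2" for z :: real
    by (simp add: power2_eq_square algebra_simps)
  have "emeasure (shifted_normal_square k) A
      = (\<integral>\<^sup>+z. ennreal (std_normal_density z) * indicator A ((z + k)\<^sup>2) \<partial>lborel)" for k
    using nn_integral_shifted_normal_square[of "indicator A" k] by simp
  moreover have "(\<integral>\<^sup>+z. ennreal (std_normal_density z) * indicator A ((z - m)\<^sup>2) \<partial>lborel)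
      = (\<integral>\<^sup>+z. ennreal (std_normal_density z) * indicator A ((z + m)\<^sup>2) \<partial>lborel)"
    by (subst nn_integral_real_affine[where c = "-1" and t = 0])
      (simp_all add: std_normal_density_def sq)
  ultimately show "emeasure (shifted_normal_square \<bar>m\<bar>) A = emeasure (shifted_normal_square m) A"
    by (auto simp: abs_if)
qed simp

text \<open>The product depends on the point only through its radius, which makes the joint law
  invariant under rotations.\<close>

lemma std_normal_density_mult:
  "ennreal (std_normal_density x) * ennreal (std_normal_density y) = ennreal (exp (- (x\<^sup>2 + y\<^sup>2) / 2) / (2 * pi))"
  by (simp add: ennreal_mult[symmetric] std_normal_density_def exp_add[symmetric] add_divide_distrib)

text \<open>Turns the convolution into an integral over the plane against the radial Gaussian
  weight, so that a rotation can act on both factors at once.\<close>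

lemma emeasure_convolution_shifted_normal_square:
  assumes [measurable]: "A \<in> sets borel"
  shows "emeasure (shifted_normal_square m \<star> shifted_normal_square k) A
    = (\<integral>\<^sup>+x. \<integral>\<^sup>+y. ennreal (exp (- (x\<^sup>2 + y\<^sup>2) / 2) / (2 * pi)) * indicator A ((x + m)\<^sup>2 + (y + k)\<^sup>2)
        \<partial>lborel \<partial>lborel)"
proof -
  have "emeasure (shifted_normal_square m \<star> shifted_normal_square k) A
      = (\<integral>\<^sup>+x. \<integral>\<^sup>+y. indicator A (x + y) \<partial>shifted_normal_square k \<partial>shifted_normal_square m)"
    by (simp add: convolution_emeasure')
  also have "\<dots> = (\<integral>\<^sup>+x. ennreal (std_normal_density x) *
      (\<integral>\<^sup>+y. ennreal (std_normal_density y) * indicator A ((x + m)\<^sup>2 + (y + k)\<^sup>2) \<partial>lborel) \<partial>lborel)"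
    by (simp add: nn_integral_shifted_normal_square)
  also have "\<dots> = (\<integral>\<^sup>+x. \<integral>\<^sup>+y. ennreal (std_normal_density x) * (ennreal (std_normal_density y)
      * indicator A ((x + m)\<^sup>2 + (y + k)\<^sup>2)) \<partial>lborel \<partial>lborel)"
    by (intro nn_integral_cong nn_integral_cmult[symmetric]) measurable
  finally show ?thesis
    by (simp only: mult.assoc[symmetric] std_normal_density_mult)
qed

text \<open>Rotate the plane so that the shift vector \<open>(m, k)\<close> falls on the first axis.
  The radial weight is unchanged, and the squared distance to \<open>(- m, - k)\<close> becomes the
  squared distance to \<open>(- r, 0)\<close>, where \<open>r\<close> is the length of the
  vector.\<close>

lemma convolution_shifted_normal_square:
  "(shifted_normal_square m \<star> shifted_normal_square k)
    = (shifted_normal_square (sqrt (m\<^sup>2 + k\<^sup>2)) \<star> shifted_normal_square 0)"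
proof -
  have rotate: "(shifted_normal_square m \<star> shifted_normal_square k)
      = (shifted_normal_square (sqrt (m\<^sup>2 + k\<^sup>2)) \<star> shifted_normal_square 0)"
    if m: "m \<noteq> 0" for m k :: real
  proof (rule measure_eqI)
    fix A assume "A \<in> sets (shifted_normal_square m \<star> shifted_normal_square k)"
    then have A [measurable]: "A \<in> sets borel" by simp
    define r where "r = sqrt (m\<^sup>2 + k\<^sup>2)"
    have r: "r\<^sup>2 = m\<^sup>2 + k\<^sup>2" "r \<noteq> 0" using m by (simp_all add: r_def sum_power2_eq_zero_iff)
    \<comment> \<open>Cosine and sine of the angle of \<open>(m, k)\<close>.\<close>
    define a b where "a = m / r" and "b = k / r"
    have mk: "m = r * a" "k = r * b" using r by (simp_all add: a_def b_def)
    have ab: "a\<^sup>2 + b\<^sup>2 = 1" "a \<noteq> 0"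
      using r m by (simp_all add: a_def b_def power_divide add_divide_distrib[symmetric])
    define h :: "real \<Rightarrow> real \<Rightarrow> ennreal"
      where "h x y = ennreal (exp (- (x\<^sup>2 + y\<^sup>2) / 2) / (2 * pi)) * indicator A ((x + m)\<^sup>2 + (y + k)\<^sup>2)" for x y
    have [measurable]: "case_prod h \<in> borel_measurable (borel \<Otimes>\<^sub>M borel)"
      unfolding h_def by measurable
    have "emeasure (shifted_normal_square m \<star> shifted_normal_square k) A
        = (\<integral>\<^sup>+x. \<integral>\<^sup>+y. h x y \<partial>lborel \<partial>lborel)"
      unfolding h_def by (rule emeasure_convolution_shifted_normal_square) fact
    also have "\<dots> = (\<integral>\<^sup>+y. \<integral>\<^sup>+x. h x y \<partial>lborel \<partial>lborel)"
      by (rule lborel_pair.Fubini'[symmetric]) measurable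
    also have "\<dots> = (\<integral>\<^sup>+u. \<integral>\<^sup>+v. h (a * u - b * v) (b * u + a * v) \<partial>lborel \<partial>lborel)"
      by (intro nn_integral_lborel_rotation ab) measurable
    also have "\<dots> = emeasure (shifted_normal_square r \<star> shifted_normal_square 0) A"
    proof -
      have "(a * u - b * v)\<^sup>2 + (b * u + a * v)\<^sup>2 = u\<^sup>2 + v\<^sup>2" for u v
        using ab(1) by algebra
      moreover have "(a * u - b * v + m)\<^sup>2 + (b * u + a * v + k)\<^sup>2 = (u + r)\<^sup>2 + (v + 0)\<^sup>2" for u v
        using ab(1) mk by algebra
      ultimately show ?thesis
        by (simp only: h_def emeasure_convolution_shifted_normal_square[OF A])
    qed
    finally show "emeasure (shifted_normal_square m \<star> shifted_normal_square k) A
        = emeasure (shifted_normal_square (sqrt (m\<^sup>2 + k\<^sup>2)) \<star> shifted_normal_square 0) A"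
      by (simp add: r_def)
  qed simp
  \<comment> \<open>For \<open>m = 0\<close> the cosine vanishes and the rotation lemma does not
    apply. The two factors are swapped instead, so that \<open>k\<close> takes the role of
    \<open>m\<close>.\<close>
  show ?thesis
  proof (cases "m = 0")
    case True
    then show ?thesis
      using rotate[of k 0] convolution_commutative[of "shifted_normal_square 0" "shifted_normal_square k"]
      by (cases "k = 0") simp_all
  qed (rule rotate)
qed

section \<open>Sums of independent squares and the non-central chi-squared law\<close>

text \<open>The law of \<open>(Z\<^sub>0 + r)\<^sup>2 + Z\<^sub>1\<^sup>2 + \<dots> + Z\<^sub>n\<^sup>2\<close>, which has \<open>n + 1\<close> degrees of freedom.\<close>
primrec chi_law :: "nat \<Rightarrow> real \<Rightarrow> real measure" where
  "chi_law 0 r = shifted_normal_square r"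
| "chi_law (Suc n) r = (chi_law n r \<star> shifted_normal_square 0)"

lemma sets_chi_law [simp, measurable_cong]: "sets (chi_law n r) = sets borel"
  by (cases n) simp_all

lemma finite_measure_chi_law [simp]: "finite_measure (chi_law n r)"
  by (induction n) (auto intro: convolution_finite)

text \<open>Commutativity and associativity carry the shifted factor past the central ones to the
  leading factor, where the two-factor case merges both shifts.\<close>

lemma chi_law_convolution:
  "(chi_law n r \<star> shifted_normal_square m) = chi_law (Suc n) (sqrt (r\<^sup>2 + m\<^sup>2))"
proof (induction n)
  case 0
  show ?case using convolution_shifted_normal_square[of r m] by simp
next
  case (Suc n)
  have "(chi_law (Suc n) r \<star> shifted_normal_square m)
      = (chi_law n r \<star> (shifted_normal_square 0 \<star> shifted_normal_square m))"
    by (simp add: convolution_associative)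
  also have "(shifted_normal_square 0 \<star> shifted_normal_square m)
      = (shifted_normal_square m \<star> shifted_normal_square 0)"
    by (rule convolution_commutative) simp_all
  also have "(chi_law n r \<star> (shifted_normal_square m \<star> shifted_normal_square 0))
      = ((chi_law n r \<star> shifted_normal_square m) \<star> shifted_normal_square 0)"
    by (rule convolution_associative) simp_all
  finally show ?case using Suc by simp
qed

text \<open>Each further square is independent of the sum of the earlier ones, so adding it
  convolves the laws, and \<open>chi_law_convolution\<close> absorbs its shift into the leading
  coordinate.\<close>

lemma (in prob_space) distr_sum_shifted_normal_squares:
  assumes indep: "indep_vars (\<lambda>_. borel) Z {..<Suc n}"
    and Z: "\<And>i. i < Suc n \<Longrightarrow> distr M borel (Z i) = std_normal_distribution"
  shows "distr M borel (\<lambda>\<omega>. \<Sum>i<Suc n. (Z i \<omega> + \<mu> i)\<^sup>2) = chi_law n (sqrt (\<Sum>i<Suc n. (\<mu> i)\<^sup>2))"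
proof -
  have law: "distr M borel (\<lambda>\<omega>. (Z i \<omega> + \<mu> i)\<^sup>2) = shifted_normal_square (\<mu> i)" if "i < Suc n" for i
  proof -
    have [measurable]: "random_variable borel (Z i)"
      using indep that by (simp add: indep_vars_def2)
    show ?thesis
      by (simp add: shifted_normal_square_def Z[OF that, symmetric] distr_distr o_def)
  qed
  have indep2: "indep_vars (\<lambda>_. borel) (\<lambda>i \<omega>. (Z i \<omega> + \<mu> i)\<^sup>2) {..<Suc n}"
    by (rule indep_vars_compose2[OF indep]) measurable
  have rv: "random_variable borel (\<lambda>\<omega>. (Z i \<omega> + \<mu> i)\<^sup>2)" if "i < Suc n" for i
    using indep2 that by (simp add: indep_vars_def2)
  show ?thesis
    using law indep2 rv
  proof (induction n)
    case 0
    show ?case using 0 by (simp add: shifted_normal_square_abs)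
  next
    case (Suc n)
    have *: "indep_var borel (\<lambda>\<omega>. (Z (Suc n) \<omega> + \<mu> (Suc n))\<^sup>2) borel (\<lambda>\<omega>. \<Sum>i<Suc n. (Z i \<omega> + \<mu> i)\<^sup>2)"
      using Suc.prems(2) by (intro indep_vars_sum) (simp_all add: lessThan_Suc)
    have "distr M borel (\<lambda>\<omega>. \<Sum>i<Suc (Suc n). (Z i \<omega> + \<mu> i)\<^sup>2)
        = (shifted_normal_square (\<mu> (Suc n)) \<star> distr M borel (\<lambda>\<omega>. \<Sum>i<Suc n. (Z i \<omega> + \<mu> i)\<^sup>2))"
      using sum_indep_random_variable[OF *] Suc.prems(1)[of "Suc n"] Suc.prems(3)
      by (simp add: add.commute)
    also have "distr M borel (\<lambda>\<omega>. \<Sum>i<Suc n. (Z i \<omega> + \<mu> i)\<^sup>2) = chi_law n (sqrt (\<Sum>i<Suc n. (\<mu> i)\<^sup>2))"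
      using Suc.prems by (intro Suc.IH) (auto intro: indep_vars_subset)
    also have "(shifted_normal_square (\<mu> (Suc n)) \<star> chi_law n (sqrt (\<Sum>i<Suc n. (\<mu> i)\<^sup>2)))
        = chi_law (Suc n) (sqrt (\<Sum>i<Suc (Suc n). (\<mu> i)\<^sup>2))"
      by (subst convolution_commutative) (simp_all del: chi_law.simps add: chi_law_convolution sum_nonneg)
    finally show ?case .
  qed
qed

text \<open>The coordinates of the product space are independent standard normal variables, so the
  law of a sum of shifted squares applies with the whole shift in coordinate 0.\<close>

lemma noncentral_chi_squared_eq_chi_law:
  assumes "0 \<le> l"
  shows "noncentral_chi_squared (Suc n) l = chi_law n (sqrt l)"
proof -
  interpret N: prob_space std_normal_distribution
    by (rule prob_space_normal_density) simp
  interpret P: product_prob_space "\<lambda>_. std_normal_distribution" "{..<Suc n}" ..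
  have law: "distr (\<Pi>\<^sub>M i\<in>{..<Suc n}. std_normal_distribution) borel (\<lambda>z. z i) = std_normal_distribution"
    if "i < Suc n" for i
  proof -
    have "distr (\<Pi>\<^sub>M i\<in>{..<Suc n}. std_normal_distribution) borel (\<lambda>z. z i)
        = distr (\<Pi>\<^sub>M i\<in>{..<Suc n}. std_normal_distribution) std_normal_distribution (\<lambda>z. z i)"
      by (rule distr_cong) simp_all
    also have "\<dots> = std_normal_distribution"
      using that by (intro distr_PiM_component) (auto intro: N.prob_space_axioms)
    finally show ?thesis .
  qed
  have "P.indep_vars (\<lambda>_. borel) (\<lambda>i z. z i) {..<Suc n}"
  proof (subst P.indep_vars_iff_distr_eq_PiM')
    show "distr (\<Pi>\<^sub>M i\<in>{..<Suc n}. std_normal_distribution) (\<Pi>\<^sub>M i\<in>{..<Suc n}. borel)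
          (\<lambda>z. \<lambda>i\<in>{..<Suc n}. z i)
        = (\<Pi>\<^sub>M i\<in>{..<Suc n}. distr (\<Pi>\<^sub>M i\<in>{..<Suc n}. std_normal_distribution) borel (\<lambda>z. z i))"
      (is "distr ?P ?B _ = ?R")
    proof -
      \<comment> \<open>Restricting to the index set is the identity on the product space, so the
        joint law of the coordinates is the product measure itself.\<close>
      have "distr ?P ?B (\<lambda>z. \<lambda>i\<in>{..<Suc n}. z i) = distr ?P ?P (\<lambda>z. z)"
        by (intro distr_cong sets_PiM_cong) (auto simp: space_PiM PiE_restrict)
      also have "\<dots> = ?P" by (rule distr_id)
      also have "\<dots> = ?R" using law by (intro PiM_cong) auto
      finally show ?thesis .
    qed
  qed auto
  from P.distr_sum_shifted_normal_squares[OF this law, where \<mu> = "\<lambda>i. if i = 0 then sqrt l else 0"] assms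
  show ?thesis
    unfolding noncentral_chi_squared_def
    by (simp add: if_distrib[of "\<lambda>x. x\<^sup>2"] cong: if_cong)
qed

section \<open>Absence of atoms and positive mass of intervals\<close>

lemma emeasure_shifted_normal_square:
  assumes [measurable]: "A \<in> sets borel"
  shows "emeasure (shifted_normal_square m) A = emeasure std_normal_distribution {z. (z + m)\<^sup>2 \<in> A}"
  unfolding shifted_normal_square_def
  by (subst emeasure_distr) (auto simp: vimage_def)

text \<open>The density is strictly positive, so both measures have the same null sets.\<close>

lemma emeasure_std_normal_eq_0_iff:
  assumes [measurable]: "A \<in> sets borel"
  shows "emeasure std_normal_distribution A = 0 \<longleftrightarrow> emeasure lborel A = 0"
proof -
  have "A \<in> null_sets std_normal_distribution \<longleftrightarrow> (AE x in lborel. x \<notin> A)"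
    using normal_density_pos[of 1 0, THEN less_imp_neq]
    by (subst null_sets_density_iff) simp_all
  also have "\<dots> \<longleftrightarrow> A \<in> null_sets lborel"
    by (rule AE_iff_null_sets[symmetric]) simp
  finally show ?thesis by (simp add: null_sets_def)
qed

text \<open>The square map has at most two preimages of a point, and a convolution with an atomless
  law is an average of masses of points.\<close>

lemma emeasure_chi_law_singleton: "emeasure (chi_law n r) {x} = 0"
proof (induction n arbitrary: x)
  case 0
  have "{z. (z + r)\<^sup>2 \<in> {x}} \<subseteq> {sqrt x - r, - sqrt x - r}"
    by (auto simp: abs_if split: if_splits)
  then have "finite {z. (z + r)\<^sup>2 \<in> {x}}" by (rule finite_subset) simp
  then have "emeasure lborel {z. (z + r)\<^sup>2 \<in> {x}} = 0"
    using finite_imp_null_set_lborel by auto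
  then show ?case
    by (simp add: emeasure_shifted_normal_square emeasure_std_normal_eq_0_iff)
next
  case (Suc n)
  \<comment> \<open>Commuted so that the inner integral measures a point under
    \<open>chi_law n r\<close>, where the induction hypothesis applies.\<close>
  have "emeasure (chi_law (Suc n) r) {x} = emeasure (shifted_normal_square 0 \<star> chi_law n r) {x}"
    unfolding chi_law.simps by (subst convolution_commutative) simp_all
  also have "\<dots> = (\<integral>\<^sup>+y. emeasure (chi_law n r) {z. z + y \<in> {x}} \<partial>shifted_normal_square 0)"
    by (rule convolution_emeasure) (auto simp: sets_eq_imp_space_eq[OF sets_chi_law]
        sets_eq_imp_space_eq[OF sets_shifted_normal_square])
  also have "\<dots> = (\<integral>\<^sup>+y. emeasure (chi_law n r) {x - y} \<partial>shifted_normal_square 0)"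
    by (intro nn_integral_cong arg_cong[where f = "emeasure _"]) auto
  finally show ?case by (simp add: Suc del: chi_law.simps)
qed

text \<open>The preimage contains a nondegenerate interval, on the branch where \<open>z + r\<close>
  is the positive root.\<close>

lemma emeasure_shifted_normal_square_interval_pos:
  assumes "0 \<le> a" "a < b"
  shows "emeasure (shifted_normal_square r) {a<..b} \<noteq> 0"
proof -
  define s where "s = sqrt a"
  have s: "0 \<le> s" "s < sqrt b" "s\<^sup>2 = a" "(sqrt b)\<^sup>2 = b" using assms by (auto simp: s_def)
  have sub: "{s - r<..sqrt b - r} \<subseteq> {z. (z + r)\<^sup>2 \<in> {a<..b}}"
  proof safe
    fix z assume "z \<in> {s - r<..sqrt b - r}"
    then have "s < z + r" "z + r \<le> sqrt b" by auto
    then show "(z + r)\<^sup>2 \<in> {a<..b}"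
      using s power_strict_mono[of s "z + r" 2] power_mono[of "z + r" "sqrt b" 2] by auto
  qed
  have "emeasure lborel {s - r<..sqrt b - r} \<le> emeasure lborel {z. (z + r)\<^sup>2 \<in> {a<..b}}"
    by (intro emeasure_mono sub) measurable
  moreover have "emeasure lborel {s - r<..sqrt b - r} \<noteq> 0"
    using s by simp
  ultimately have "emeasure lborel {z. (z + r)\<^sup>2 \<in> {a<..b}} \<noteq> 0" by auto
  then show ?thesis
    by (simp add: emeasure_shifted_normal_square emeasure_std_normal_eq_0_iff)
qed

text \<open>With \<open>c\<close> the midpoint, a first summand in \<open>{a<..c}\<close> and a
  second in \<open>{0<..b - c}\<close> have their sum in \<open>{a<..b}\<close>; the product of the
  two positive masses is a lower bound.\<close>

lemma emeasure_chi_law_interval_pos: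
  assumes "0 \<le> a" "a < b"
  shows "emeasure (chi_law n r) {a<..b} \<noteq> 0"
  using assms
proof (induction n arbitrary: a b r)
  case 0
  show ?case using emeasure_shifted_normal_square_interval_pos[OF 0] by simp
next
  case (Suc n)
  define c where "c = (a + b) / 2"
  have c: "a < c" "c < b" using Suc.prems by (auto simp: c_def)
  define e where "e = emeasure (shifted_normal_square 0) {0<..b - c}"
  have "e \<noteq> 0" using c emeasure_shifted_normal_square_interval_pos[of 0 "b - c" 0] by (simp add: e_def)
  have "e * emeasure (chi_law n r) {a<..c} = (\<integral>\<^sup>+x. e * indicator {a<..c} x \<partial>chi_law n r)"
    by (subst nn_integral_cmult_indicator) simp_all
  also have "\<dots> \<le> (\<integral>\<^sup>+x. emeasure (shifted_normal_square 0) {y. y + x \<in> {a<..b}} \<partial>chi_law n r)"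
    using c by (intro nn_integral_mono) (auto simp: e_def intro!: emeasure_mono split: split_indicator)
  also have "\<dots> = emeasure (chi_law (Suc n) r) {a<..b}"
    unfolding chi_law.simps
    by (rule convolution_emeasure[symmetric]) (auto simp: sets_eq_imp_space_eq[OF sets_chi_law]
        sets_eq_imp_space_eq[OF sets_shifted_normal_square])
  finally show ?case using \<open>e \<noteq> 0\<close> Suc.IH[of a c r] Suc.prems(1) c by auto
qed

section \<open>Inversion of the distribution function\<close>

text \<open>Without atoms the distribution function is continuous, and positive mass of intervals
  makes it strictly increasing on the nonnegative half-line. The intermediate value theorem then
  gives exactly one solution, as the definite description in \<open>quantile\<close>
  requires.\<close>

lemma (in real_distribution) quantile_inverts_cdf:
  assumes atomless: "\<And>x. measure M {x} = 0"
    and pos: "\<And>x y. 0 \<le> x \<Longrightarrow> x < y \<Longrightarrow> measure M {x<..y} > 0"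
    and zero: "cdf M 0 = 0"
    and p: "0 < p" "p < 1"
  shows "0 < quantile M p" and "cdf M x \<le> p \<longleftrightarrow> x \<le> quantile M p" and "cdf M (quantile M p) = p"
proof -
  have less: "cdf M x < cdf M y" if "0 \<le> x" "x < y" for x y
    using pos[OF that] cdf_diff_eq[OF that(2)] by simp
  have positive: "0 < x" if "0 < cdf M x" for x
    using that zero cdf_nondecreasing[of x 0] by (cases "x \<le> 0") auto
  have "eventually (\<lambda>x. cdf M x > p) at_top"
    using cdf_lim_at_top_prob p(2) by (rule order_tendstoD)
  then obtain t where t: "cdf M t > p"
    by (auto simp: eventually_at_top_linorder)
  have "0 < t" using positive[of t] t p by simp
  have "\<exists>q\<ge>0. q \<le> t \<and> cdf M q = p"
    using t \<open>0 < t\<close> p zero IVT[of "cdf M" 0 p t] by (simp add: isCont_cdf atomless)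
  then obtain q where q: "cdf M q = p" by blast
  \<comment> \<open>Since \<open>p > 0\<close>, every solution is positive and thus lies where the
    function is strictly increasing.\<close>
  have "q' = q" if "cdf M q' = p" for q'
    using less[of q q'] less[of q' q] positive[of q] positive[of q'] that q p
    by (cases q q' rule: linorder_cases) simp_all
  then have quantile: "quantile M p = q"
    unfolding quantile_def using q by (intro the_equality)
  show "0 < quantile M p" "cdf M (quantile M p) = p"
    using quantile q p positive[of q] by auto
  then show "cdf M x \<le> p \<longleftrightarrow> x \<le> quantile M p"
    using less[of "quantile M p" x] cdf_nondecreasing[of x "quantile M p"]
    by (cases "x \<le> quantile M p") simp_all
qed

lemma real_distribution_noncentral_chi_squared: "real_distribution (noncentral_chi_squared n l)"
proof -
  interpret N: prob_space std_normal_distribution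
    by (rule prob_space_normal_density) simp
  interpret P: product_prob_space "\<lambda>_. std_normal_distribution" "{..<n}" ..
  show ?thesis
    unfolding noncentral_chi_squared_def by (rule P.real_distribution_distr) measurable
qed

lemma
  assumes "1 \<le> n" "0 \<le> l"
  shows measure_noncentral_chi_squared_singleton: "measure (noncentral_chi_squared n l) {x} = 0"
    and measure_noncentral_chi_squared_interval_pos:
      "0 \<le> a \<Longrightarrow> a < b \<Longrightarrow> measure (noncentral_chi_squared n l) {a<..b} > 0"
    and cdf_noncentral_chi_squared_0: "cdf (noncentral_chi_squared n l) 0 = 0"
proof -
  interpret real_distribution "noncentral_chi_squared n l"
    by (rule real_distribution_noncentral_chi_squared)
  \<comment> \<open>\<open>chi_law m\<close> has \<open>m + 1\<close> degrees of freedom, hence the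
    predecessor of \<open>n\<close>.\<close>
  obtain m where n: "n = Suc m" using assms by (cases n) auto
  have eq: "noncentral_chi_squared n l = chi_law m (sqrt l)"
    using noncentral_chi_squared_eq_chi_law[OF assms(2)] n by simp
  show singleton: "measure (noncentral_chi_squared n l) {x} = 0" for x
    by (simp add: measure_def eq emeasure_chi_law_singleton)
  show "measure (noncentral_chi_squared n l) {a<..b} > 0" if "0 \<le> a" "a < b" for a b
    using emeasure_chi_law_interval_pos[OF that, of m "sqrt l"]
    by (simp add: eq[symmetric] emeasure_eq_measure zero_less_measure_iff)
  \<comment> \<open>A sum of squares is never negative; the remaining point 0 of
    \<open>{..0}\<close> is not an atom.\<close>
  have "emeasure (noncentral_chi_squared n l) {..<0} = 0"
  proof -
    have "(\<lambda>z. \<Sum>i<n. (z i + (if i = 0 then sqrt l else 0))\<^sup>2) -` {..<0} = {}"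
      by (simp add: vimage_def not_less sum_nonneg)
    then show ?thesis
      unfolding noncentral_chi_squared_def by (subst emeasure_distr) simp_all
  qed
  then have "measure (noncentral_chi_squared n l) ({..<0} \<union> {0}) = 0"
    by (subst finite_measure_Union) (auto simp: measure_def singleton[unfolded measure_def])
  also have "{..<0} \<union> {0} = {..0::real}" by auto
  finally show "cdf (noncentral_chi_squared n l) 0 = 0" by (simp add: cdf_def)
qed

section \<open>Law of the test statistic for a fixed diffusion coefficient\<close>

lemma (in prob_space) distr_scaled_normal:
  assumes "distributed M lborel Y (normal_density 0 s)" "0 < s"
  shows "distr M borel (\<lambda>\<omega>. Y \<omega> / s) = std_normal_distribution"
proof -
  have "distributed M lborel (\<lambda>\<omega>. Y \<omega> / s) std_normal_density"
    using assms normal_standard_normal_convert[of s Y 0] by simp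
  then have "distr M lborel (\<lambda>\<omega>. Y \<omega> / s) = std_normal_distribution"
    by (rule distributed_distr_eq_density)
  moreover have "distr M borel (\<lambda>\<omega>. Y \<omega> / s) = distr M lborel (\<lambda>\<omega>. Y \<omega> / s)"
    by (rule distr_cong) simp_all
  ultimately show ?thesis by simp
qed

context
  fixes M :: "'a measure" and W X :: "real \<Rightarrow> 'a \<Rightarrow> real" and x0 \<sigma> \<Delta> T :: real
    and b :: "real \<Rightarrow> real" and n :: nat
  assumes n: "n \<ge> 1" and \<Delta>: "\<Delta> > 0" and T: "real n * \<Delta> = T"
    and b: "b integrable_on {0..T}"
    and W: "brownian_motion M W"
    and X: "sde_solution M W x0 b \<sigma> T X"
    and \<sigma>: "\<sigma> \<noteq> 0"
begin

interpretation brownian_motion M W by (rule W)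

lemma grid_point:
  assumes "i \<le> n"
  shows "real i * \<Delta> \<in> {0..T}"
  using assms \<Delta> T by (auto simp: mult_right_mono)

text \<open>The index is moved from \<open>{1..n}\<close> to \<open>{..<n}\<close> to match the
  indexing in \<open>indep_increments\<close>.\<close>

lemma test_statistic_Suc:
  "test_statistic X \<Delta> n \<omega>
    = 1 / real n * (\<Sum>i<n. ((X (real (Suc i) * \<Delta>) \<omega> - X (real i * \<Delta>) \<omega>) / sqrt \<Delta>)\<^sup>2)"
proof -
  have "(\<Sum>i=1..n. (normalized_increment X \<Delta> i \<omega>)\<^sup>2) = (\<Sum>i<n. (normalized_increment X \<Delta> (Suc i) \<omega>)\<^sup>2)"
    by (rule sum.reindex_bij_witness[of _ Suc "\<lambda>i. i - 1"]) auto
  then show ?thesis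
    by (simp add: test_statistic_def normalized_increment_def)
qed

text \<open>Each summand is the squared shift that the drift causes in one increment after division
  by \<open>\<sigma>\<close>.\<close>

lemma noncentrality_Suc:
  "noncentrality b \<Delta> n \<sigma>
    = (\<Sum>i<n. (integral {real i * \<Delta>..real (Suc i) * \<Delta>} b / (\<sigma> * sqrt \<Delta>))\<^sup>2)"
proof -
  have "(\<Sum>i=1..n. (integral {(real i - 1) * \<Delta>..real i * \<Delta>} b)\<^sup>2)
      = (\<Sum>i<n. (integral {(real (Suc i) - 1) * \<Delta>..real (Suc i) * \<Delta>} b)\<^sup>2)"
    by (rule sum.reindex_bij_witness[of _ Suc "\<lambda>i. i - 1"]) auto
  then show ?thesis
    using \<Delta> by (simp add: noncentrality_def power_divide power_mult_distrib sum_divide_distrib)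
qed

lemma measurable_test_statistic: "test_statistic X \<Delta> n \<in> borel_measurable M"
proof -
  have [measurable]: "X (real i * \<Delta>) \<in> borel_measurable M" if "i \<le> n" for i
    using X grid_point[OF that] by (simp add: sde_solution_def)
  have "(\<lambda>\<omega>. \<Sum>i<n. ((X (real (Suc i) * \<Delta>) \<omega> - X (real i * \<Delta>) \<omega>) / sqrt \<Delta>)\<^sup>2) \<in> borel_measurable M"
    by (rule borel_measurable_sum) (measurable; simp)
  then show ?thesis
    by (simp add: test_statistic_Suc[abs_def])
qed

text \<open>Subtracting the integral equation at neighbouring grid points cancels \<open>x0\<close>
  and the earlier drift. What remains, divided by \<open>\<sigma> * sqrt \<Delta>\<close>, is a
  standardized Brownian increment plus a deterministic shift.\<close>

lemma AE_test_statistic: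
  "AE \<omega> in M. real n * test_statistic X \<Delta> n \<omega> / \<sigma>\<^sup>2
    = (\<Sum>i<n. ((W (real (Suc i) * \<Delta>) \<omega> - W (real i * \<Delta>) \<omega>) / sqrt \<Delta>
        + integral {real i * \<Delta>..real (Suc i) * \<Delta>} b / (\<sigma> * sqrt \<Delta>))\<^sup>2)"
proof -
  have "AE \<omega> in M. \<forall>t\<in>{0..T}. X t \<omega> = x0 + integral {0..t} b + \<sigma> * W t \<omega>"
    using X by (simp add: sde_solution_def)
  then show ?thesis
  proof eventually_elim
    case (elim \<omega>)
    have "((X (real (Suc i) * \<Delta>) \<omega> - X (real i * \<Delta>) \<omega>) / sqrt \<Delta>)\<^sup>2
        = \<sigma>\<^sup>2 * ((W (real (Suc i) * \<Delta>) \<omega> - W (real i * \<Delta>) \<omega>) / sqrt \<Delta>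
          + integral {real i * \<Delta>..real (Suc i) * \<Delta>} b / (\<sigma> * sqrt \<Delta>))\<^sup>2" if "i < n" for i
    proof -
      define s t where "s = real i * \<Delta>" and "t = real (Suc i) * \<Delta>"
      have st: "s \<in> {0..T}" "t \<in> {0..T}" "s \<le> t"
        using grid_point[of i] grid_point[of "Suc i"] that \<Delta> by (auto simp: s_def t_def)
      have "b integrable_on {0..t}"
        by (rule integrable_on_subinterval[OF b]) (use st in auto)
      then have "integral {0..s} b + integral {s..t} b = integral {0..t} b"
        using st by (intro Henstock_Kurzweil_Integration.integral_combine) auto
      then have incr: "X t \<omega> - X s \<omega> = \<sigma> * (W t \<omega> - W s \<omega>) + integral {s..t} b"
        using elim st by (simp add: algebra_simps)
      have "(X t \<omega> - X s \<omega>) / sqrt \<Delta>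
          = \<sigma> * ((W t \<omega> - W s \<omega>) / sqrt \<Delta> + integral {s..t} b / (\<sigma> * sqrt \<Delta>))"
        unfolding incr using \<sigma> \<Delta> by (simp add: field_simps)
      then show ?thesis
        by (simp only: s_def[symmetric] t_def[symmetric] power_mult_distrib)
    qed
    then show ?case
      using n \<sigma> by (simp add: test_statistic_Suc sum_distrib_left[symmetric] del: of_nat_Suc)
  qed
qed

text \<open>Brownian increments over the grid are independent with variance \<open>\<Delta>\<close>,
  so dividing by \<open>sqrt \<Delta>\<close> gives independent standard normal variables.\<close>

lemma distr_test_statistic:
  "distr M borel (\<lambda>\<omega>. real n * test_statistic X \<Delta> n \<omega> / \<sigma>\<^sup>2)
    = noncentral_chi_squared n (noncentrality b \<Delta> n \<sigma>)"
proof -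
  define Z where "Z i \<omega> = (W (real (Suc i) * \<Delta>) \<omega> - W (real i * \<Delta>) \<omega>) / sqrt \<Delta>" for i \<omega>
  define \<mu> where "\<mu> i = integral {real i * \<Delta>..real (Suc i) * \<Delta>} b / (\<sigma> * sqrt \<Delta>)" for i
  obtain m where m: "n = Suc m" using n by (cases n) auto
  have "indep_vars (\<lambda>_. borel) (\<lambda>i \<omega>. W (real (Suc i) * \<Delta>) \<omega> - W (real i * \<Delta>) \<omega>) {..<n}"
    using \<Delta> by (intro indep_increments) auto
  then have indep: "indep_vars (\<lambda>_. borel) Z {..<n}"
    unfolding Z_def by (rule indep_vars_compose2) measurable
  have Z: "distr M borel (Z i) = std_normal_distribution" for i
  proof -
    have "distributed M lborel (\<lambda>\<omega>. W (real (Suc i) * \<Delta>) \<omega> - W (real i * \<Delta>) \<omega>)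
        (normal_density 0 (sqrt (real (Suc i) * \<Delta> - real i * \<Delta>)))"
      using \<Delta> by (intro normal_increments) auto
    moreover have "real (Suc i) * \<Delta> - real i * \<Delta> = \<Delta>" by (simp add: algebra_simps)
    ultimately show ?thesis
      unfolding Z_def[abs_def] using \<Delta> by (intro distr_scaled_normal) auto
  qed
  have "Z i \<in> borel_measurable M" if "i < n" for i
    using indep that by (simp add: indep_vars_def2)
  then have "(\<lambda>\<omega>. \<Sum>i<n. (Z i \<omega> + \<mu> i)\<^sup>2) \<in> borel_measurable M"
    by (intro borel_measurable_sum borel_measurable_power borel_measurable_add) auto
  \<comment> \<open>Equality almost everywhere between measurable functions is enough for equal
    laws.\<close>
  then have "distr M borel (\<lambda>\<omega>. real n * test_statistic X \<Delta> n \<omega> / \<sigma>\<^sup>2)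
      = distr M borel (\<lambda>\<omega>. \<Sum>i<n. (Z i \<omega> + \<mu> i)\<^sup>2)"
    using AE_test_statistic measurable_test_statistic unfolding Z_def \<mu>_def
    by (intro distr_cong_AE borel_measurable_divide borel_measurable_times) simp_all
  also have "\<dots> = chi_law m (sqrt (\<Sum>i<n. (\<mu> i)\<^sup>2))"
    using distr_sum_shifted_normal_squares[of Z m \<mu>] indep Z m by simp
  also have "\<dots> = noncentral_chi_squared n (\<Sum>i<n. (\<mu> i)\<^sup>2)"
    unfolding m by (rule noncentral_chi_squared_eq_chi_law[symmetric]) (simp add: sum_nonneg)
  also have "(\<Sum>i<n. (\<mu> i)\<^sup>2) = noncentrality b \<Delta> n \<sigma>"
    unfolding noncentrality_Suc \<mu>_def ..
  finally show ?thesis .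
qed

text \<open>Acceptance is a strict inequality, whereas the distribution function uses a closed
  half-line; the boundary point carries no mass.\<close>

lemma prob_test_statistic_less:
  "prob {\<omega> \<in> space M. test_statistic X \<Delta> n \<omega> < z}
    = cdf (noncentral_chi_squared n (noncentrality b \<Delta> n \<sigma>)) (real n * z / \<sigma>\<^sup>2)"
proof -
  define c where "c = real n * z / \<sigma>\<^sup>2"
  let ?N = "noncentral_chi_squared n (noncentrality b \<Delta> n \<sigma>)"
  interpret N: real_distribution ?N
    by (rule real_distribution_noncentral_chi_squared)
  have l: "0 \<le> noncentrality b \<Delta> n \<sigma>"
    unfolding noncentrality_Suc by (intro sum_nonneg) simp
  note measurable_test_statistic [measurable]
  have "{\<omega> \<in> space M. test_statistic X \<Delta> n \<omega> < z}
      = (\<lambda>\<omega>. real n * test_statistic X \<Delta> n \<omega> / \<sigma>\<^sup>2) -` {..<c} \<inter> space M"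
    using n \<sigma> by (auto simp: c_def divide_less_cancel)
  then have "prob {\<omega> \<in> space M. test_statistic X \<Delta> n \<omega> < z} = measure ?N {..<c}"
    unfolding distr_test_statistic[symmetric] by (subst measure_distr) auto
  also have "\<dots> = measure ?N ({..<c} \<union> {c})"
    using measure_noncentral_chi_squared_singleton[OF n l, of c]
    by (subst N.finite_measure_Union) auto
  also have "{..<c} \<union> {c} = {..c}" by auto
  finally show ?thesis by (simp add: cdf_def c_def)
qed

end

section \<open>Type I error and the exact power condition\<close>

theorem proposition1:
  fixes P :: "real \<Rightarrow> 'a measure" and X :: "real \<Rightarrow> 'a \<Rightarrow> real"
    and x0 T \<Delta> \<alpha> \<sigma>0 :: real and b :: "real \<Rightarrow> real" and n :: nat
  assumes "n \<ge> 1" and "\<Delta> > 0" and "real n * \<Delta> = T"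
    and "b absolutely_integrable_on {0..T}"
    and "diffusion_model P X x0 b T"
    and "0 < \<alpha>" and "\<alpha> < 1" and "\<sigma>0\<^sup>2 > 0"
  shows "measure (P (\<sigma>0\<^sup>2)) {\<omega> \<in> space (P (\<sigma>0\<^sup>2)). test_rejects b \<Delta> n \<sigma>0 \<alpha> X \<omega>} = \<alpha>
    \<and> has_level P {\<sigma>0\<^sup>2} (test_rejects b \<Delta> n \<sigma>0 \<alpha> X) \<alpha>
    \<and> (\<forall>\<beta>. 0 < \<beta> \<and> \<beta> < 1 \<and> 1 - \<beta> \<ge> \<alpha> \<longrightarrow>
        (\<forall>\<sigma>. \<sigma>\<^sup>2 > 0 \<longrightarrow>
          (\<sigma>\<^sup>2 \<ge> \<sigma>0\<^sup>2 * (chi_quantile b \<Delta> n \<sigma>0 (1 - \<alpha>) / chi_quantile b \<Delta> n \<sigma> \<beta>) \<longleftrightarrow>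
           measure (P (\<sigma>\<^sup>2)) {\<omega> \<in> space (P (\<sigma>\<^sup>2)). test_accepts b \<Delta> n \<sigma>0 \<alpha> X \<omega>} \<le> \<beta>)))"
proof -
  let ?N = "\<lambda>\<sigma>. noncentral_chi_squared n (noncentrality b \<Delta> n \<sigma>)"
  define q where "q = chi_quantile b \<Delta> n \<sigma>0 (1 - \<alpha>)"
  have int: "b integrable_on {0..T}"
    using assms(4) by (simp add: absolutely_integrable_on_def)
  have crit: "real n * critical_value b \<Delta> n \<sigma>0 \<alpha> = \<sigma>0\<^sup>2 * q"
    using assms(1) by (simp add: critical_value_def q_def)
  have quantile: "0 < chi_quantile b \<Delta> n \<sigma> p"
      "cdf (?N \<sigma>) x \<le> p \<longleftrightarrow> x \<le> chi_quantile b \<Delta> n \<sigma> p"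
      "cdf (?N \<sigma>) (chi_quantile b \<Delta> n \<sigma> p) = p"
    if "0 < p" "p < 1" for \<sigma> p x
  proof -
    interpret real_distribution "?N \<sigma>"
      by (rule real_distribution_noncentral_chi_squared)
    \<comment> \<open>This also covers \<open>\<sigma> = 0\<close>, where division by zero gives the
      value 0.\<close>
    have l: "0 \<le> noncentrality b \<Delta> n \<sigma>"
      using assms(2) by (simp add: noncentrality_def sum_nonneg)
    note * = quantile_inverts_cdf[OF measure_noncentral_chi_squared_singleton[OF assms(1) l]
        measure_noncentral_chi_squared_interval_pos[OF assms(1) l]
        cdf_noncentral_chi_squared_0[OF assms(1) l] that, folded chi_quantile_def]
    show "0 < chi_quantile b \<Delta> n \<sigma> p" "cdf (?N \<sigma>) x \<le> p \<longleftrightarrow> x \<le> chi_quantile b \<Delta> n \<sigma> p"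
      "cdf (?N \<sigma>) (chi_quantile b \<Delta> n \<sigma> p) = p"
      by (rule *; assumption)+
  qed
  have model: "prob_space (P (\<sigma>\<^sup>2)) \<and> test_statistic X \<Delta> n \<in> borel_measurable (P (\<sigma>\<^sup>2)) \<and>
      measure (P (\<sigma>\<^sup>2)) {\<omega> \<in> space (P (\<sigma>\<^sup>2)). test_accepts b \<Delta> n \<sigma>0 \<alpha> X \<omega>} = cdf (?N \<sigma>) (\<sigma>0\<^sup>2 * q / \<sigma>\<^sup>2)"
    if "\<sigma>\<^sup>2 > 0" for \<sigma>
  proof -
    \<comment> \<open>The model fixes only the square, so \<open>\<tau>\<close> may be
      \<open>- \<sigma>\<close>; the noncentrality and the rescaled threshold depend on the square
      alone.\<close>
    obtain W \<tau> where \<tau>: "\<tau>\<^sup>2 = \<sigma>\<^sup>2" and W: "brownian_motion (P (\<sigma>\<^sup>2)) W"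
      and X: "sde_solution (P (\<sigma>\<^sup>2)) W x0 b \<tau> T X"
      using assms(5) \<open>\<sigma>\<^sup>2 > 0\<close> unfolding diffusion_model_def by blast
    have "\<tau> \<noteq> 0" using \<tau> that by auto
    note facts = assms(1-3) int W X \<open>\<tau> \<noteq> 0\<close>
    have "noncentrality b \<Delta> n \<tau> = noncentrality b \<Delta> n \<sigma>"
      by (simp add: noncentrality_def \<tau>)
    then show ?thesis
      using prob_test_statistic_less[OF facts, of "critical_value b \<Delta> n \<sigma>0 \<alpha>"]
        measurable_test_statistic[OF facts] W
      by (simp add: test_accepts_def test_rejects_def not_le \<tau> crit brownian_motion_def)
  qed
  have "measure (P (\<sigma>0\<^sup>2)) {\<omega> \<in> space (P (\<sigma>0\<^sup>2)). test_rejects b \<Delta> n \<sigma>0 \<alpha> X \<omega>} = \<alpha>"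
  proof -
    interpret prob_space "P (\<sigma>0\<^sup>2)" using model[OF assms(8)] by simp
    have [measurable]: "test_statistic X \<Delta> n \<in> borel_measurable (P (\<sigma>0\<^sup>2))"
      using model[OF assms(8)] by simp
    \<comment> \<open>Under the null value the factors \<open>\<sigma>0\<^sup>2\<close> cancel, and
      the distribution function is evaluated at its own quantile \<open>q\<close>.\<close>
    have "prob {\<omega> \<in> space (P (\<sigma>0\<^sup>2)). test_accepts b \<Delta> n \<sigma>0 \<alpha> X \<omega>} = 1 - \<alpha>"
      using model[OF assms(8)] assms(6-8) quantile(3)[of "1 - \<alpha>" \<sigma>0] by (simp add: q_def)
    moreover have "{\<omega> \<in> space (P (\<sigma>0\<^sup>2)). test_rejects b \<Delta> n \<sigma>0 \<alpha> X \<omega>}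
        = space (P (\<sigma>0\<^sup>2)) - {\<omega> \<in> space (P (\<sigma>0\<^sup>2)). test_accepts b \<Delta> n \<sigma>0 \<alpha> X \<omega>}"
      by (auto simp: test_accepts_def)
    ultimately show ?thesis
      by (simp add: prob_compl test_accepts_def test_rejects_def)
  qed
  moreover have "\<sigma>\<^sup>2 \<ge> \<sigma>0\<^sup>2 * (q / chi_quantile b \<Delta> n \<sigma> \<beta>) \<longleftrightarrow>
      measure (P (\<sigma>\<^sup>2)) {\<omega> \<in> space (P (\<sigma>\<^sup>2)). test_accepts b \<Delta> n \<sigma>0 \<alpha> X \<omega>} \<le> \<beta>"
    if "0 < \<beta>" "\<beta> < 1" "\<sigma>\<^sup>2 > 0" for \<beta> \<sigma>
  proof -
    \<comment> \<open>The quantile and \<open>\<sigma>\<^sup>2\<close> are both positive and can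
      trade places. The right-hand side is then equivalent to an acceptance probability of at most
      \<open>\<beta>\<close>, which gives sufficiency and necessity together.\<close>
    have "\<sigma>\<^sup>2 \<ge> \<sigma>0\<^sup>2 * (q / chi_quantile b \<Delta> n \<sigma> \<beta>) \<longleftrightarrow> \<sigma>0\<^sup>2 * q / \<sigma>\<^sup>2 \<le> chi_quantile b \<Delta> n \<sigma> \<beta>"
      using quantile(1)[OF that(1,2), of \<sigma>] that(3) by (simp add: pos_divide_le_eq mult.commute)
    then show ?thesis
      using model[OF that(3)] quantile(2)[OF that(1,2)] by simp
  qed
  ultimately show ?thesis
    unfolding has_level_def q_def by simp
qed

end
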